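(* Let $\mathcal{C}$ be a set and $\epsilon:\mathcal{C}^2\to\{0,1\}$ a minimal energy. For any integer $n$ and any state $C$, a finite non-commutative product of elements of $\mathcal{C}$, there exists a bijection between $\{\lambda\in\mathcal{O}_\epsilon:(C(\lambda),|\lambda|)=(C,n)\}$ and $\{\nu\in\mathcal{E}_\epsilon:(C(\nu),|\nu|)=(C,n)\}$. In particular, for $\rho\in\{0,1\}$, we have $$|\{\nu\in\mathcal{E}_\epsilon^{\rho_+}:(C(\nu),|\nu|)=(C,n)\}|=|\{\lambda\in\mathcal{O}_\epsilon^{\rho_+}:(C(\lambda),|\lambda|)=(C,n)\}|,$$ $$|\{\nu\in\mathcal{E}_\epsilon^{\rho_-}:(C(\nu),|\nu|)=(C,n)\}|=|\{\lambda\in\mathcal{O}_\epsilon^{\rho_-}:(C(\lambda),|\lambda|)=(C,n)\}|.$$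
   Context: Let $\mathcal{C}$ be a set (countable or not) whose elements are called (primary) states. A minimal energy is a function $\epsilon:\mathcal{C}^2\to\{0,1\}$. A primary particle is a pair $(k,c)\in\mathcal{P}=\mathbb{Z}\times\mathcal{C}$, with potential $k$ and state $c$. Define $(k,c)\succ_\epsilon(k',c')$ if and only if $k-k'\ge\epsilon(c,c')$. A secondary particle is a triple $(k,c,c')\in\mathcal{S}_\epsilon=\mathbb{Z}\times\mathcal{C}^2$; it represents the sum $(k+\epsilon(c,c'),c)+(k,c')$, has potential $2k+\epsilon(c,c')$ and state the non-commutative product $cc'$. Its upper half is $\gamma(k,c,c')=(k+\epsilon(c,c'),c)$ and its lower half is $\mu(k,c,c')=(k,c')$. The relation $\gg_\epsilon$ on $\mathcal{P}\sqcup\mathcal{S}_\epsilon$ is defined by: (1) $(k,c)\gg_\epsilon(k',c')$ iff $k-k'>\epsilon(c,c')$; (2) $(k,c)\gg_\epsilon(k',c',c'')$ iff $k-(2k'+\epsilon(c',c''))\ge\epsilon(c,c')+\epsilon(c',c'')$; (3) $(k,c,c')\gg_\epsilon(k',c'')$ iff $(2k+\epsilon(c,c'))-k'>\epsilon(c,c')+\epsilon(c',c'')$; (4) $(k,c,c')\gg_\epsilon(k',c'',c''')$ iff $\mu(k,c,c')\succ_\epsilon\gamma(k',c'',c''')$, i.e. $k-k'\ge\epsilon(c',c'')+\epsilon(c'',c''')$. A generalized colored partition with relation $R$ is a finite sequence of particles $\pi=(\pi_1,\ldots,\pi_s)$ with $\pi_i\,R\,\pi_{i+1}$ for all $1\le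 i\le s-1$. Its energy $|\pi|$ is the sum of the potentials, and its state $C(\pi)$ is the non-commutative product (concatenation) of the states of $\pi_1,\ldots,\pi_s$, seen as a word in elements of $\mathcal{C}$. $\mathcal{O}_\epsilon$ (resp. $\mathcal{E}_\epsilon$) is the set of generalized colored partitions with particles in $\mathcal{P}$ and relation $\succ_\epsilon$ (resp. particles in $\mathcal{P}\sqcup\mathcal{S}_\epsilon$ and relation $\gg_\epsilon$). For $\rho\in\{0,1\}$ let $\mathcal{P}^{\rho_+}=\{(k,c)\in\mathcal{P}:k\ge\rho\}$, $\mathcal{S}_\epsilon^{\rho_+}=\{(k,c,c')\in\mathcal{S}_\epsilon:k\ge\rho\}$, $\mathcal{P}^{\rho_-}=\{(k,c)\in\mathcal{P}:k\le\rho\}$, $\mathcal{S}_\epsilon^{\rho_-}=\{(k,c,c')\in\mathcal{S}_\epsilon:k+\epsilon(c,c')\le\rho\}$. Then $\mathcal{O}_\epsilon^{\rho_\pm}$ is the subset of $\mathcal{O}_\epsilon$ of partitions with all particles in $\mathcal{P}^{\rho_\pm}$, and $\mathcal{E}_\epsilon^{\rho_\pm}$ is the subset of $\mathcal{E}_\epsilon$ of partitions with all particles in $\mathcal{P}^{\rho_\pm}\sqcup\mathcal{S}_\epsilon^{\rho_\pm}$. *)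

theory Defs
  imports "HOL-Library.Equipollence"
begin

definition minimal_energy :: "('c \<Rightarrow> 'c \<Rightarrow> int) \<Rightarrow> bool" where
  "minimal_energy \<epsilon> \<longleftrightarrow> (\<forall>c c'. \<epsilon> c c' \<in> {0, 1})"

type_synonym 'c primary = "int \<times> 'c"

text \<open>The integer in a secondary particle is the potential of its lower half, not its own potential.\<close>

type_synonym 'c secondary = "int \<times> 'c \<times> 'c"

type_synonym 'c particle = "'c primary + 'c secondary"

text \<open>States are words over the primary states: a non-commutative product is a list, and
  multiplication is concatenation.\<close>

fun primary_potential :: "'c primary \<Rightarrow> int" where
  "primary_potential (k, c) = k"

fun primary_state :: "'c primary \<Rightarrow> 'c list" where
  "primary_state (k, c) = [c]"

fun secondary_potential :: "('c \<Rightarrow> 'c \<Rightarrow> int) \<Rightarrow> 'c secondary \<Rightarrow> int" where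
  "secondary_potential \<epsilon> (k, c, c') = 2 * k + \<epsilon> c c'"

fun secondary_state :: "'c secondary \<Rightarrow> 'c list" where
  "secondary_state (k, c, c') = [c, c']"

fun upper_half :: "('c \<Rightarrow> 'c \<Rightarrow> int) \<Rightarrow> 'c secondary \<Rightarrow> 'c primary" where
  "upper_half \<epsilon> (k, c, c') = (k + \<epsilon> c c', c)"

fun lower_half :: "'c secondary \<Rightarrow> 'c primary" where
  "lower_half (k, c, c') = (k, c')"

fun potential :: "('c \<Rightarrow> 'c \<Rightarrow> int) \<Rightarrow> 'c particle \<Rightarrow> int" where
  "potential \<epsilon> (Inl p) = primary_potential p"
| "potential \<epsilon> (Inr s) = secondary_potential \<epsilon> s"

fun state :: "'c particle \<Rightarrow> 'c list" where
  "state (Inl p) = primary_state p"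
| "state (Inr s) = secondary_state s"

fun succ_rel :: "('c \<Rightarrow> 'c \<Rightarrow> int) \<Rightarrow> 'c primary \<Rightarrow> 'c primary \<Rightarrow> bool" where
  "succ_rel \<epsilon> (k, c) (k', c') \<longleftrightarrow> k - k' \<ge> \<epsilon> c c'"

fun gg_rel :: "('c \<Rightarrow> 'c \<Rightarrow> int) \<Rightarrow> 'c particle \<Rightarrow> 'c particle \<Rightarrow> bool" where
  "gg_rel \<epsilon> (Inl (k, c)) (Inl (k', c')) \<longleftrightarrow> k - k' > \<epsilon> c c'"
| "gg_rel \<epsilon> (Inl (k, c)) (Inr (k', c', c'')) \<longleftrightarrow>
     k - (2 * k' + \<epsilon> c' c'') \<ge> \<epsilon> c c' + \<epsilon> c' c''"
| "gg_rel \<epsilon> (Inr (k, c, c')) (Inl (k', c'')) \<longleftrightarrow>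
     (2 * k + \<epsilon> c c') - k' > \<epsilon> c c' + \<epsilon> c' c''"
| "gg_rel \<epsilon> (Inr s) (Inr s') \<longleftrightarrow> succ_rel \<epsilon> (lower_half s) (upper_half \<epsilon> s')"

definition colored_partitions :: "('p \<Rightarrow> 'p \<Rightarrow> bool) \<Rightarrow> 'p set \<Rightarrow> 'p list set" where
  "colored_partitions R A = {\<pi>. set \<pi> \<subseteq> A \<and> successively R \<pi>}"

definition energy :: "('p \<Rightarrow> int) \<Rightarrow> 'p list \<Rightarrow> int" where
  "energy pot \<pi> = sum_list (map pot \<pi>)"

definition word :: "('p \<Rightarrow> 'c list) \<Rightarrow> 'p list \<Rightarrow> 'c list" where
  "word st \<pi> = concat (map st \<pi>)"

definition P_plus :: "int \<Rightarrow> 'c primary set" where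
  "P_plus \<rho> = {(k, c). k \<ge> \<rho>}"

definition S_plus :: "int \<Rightarrow> 'c secondary set" where
  "S_plus \<rho> = {(k, c, c'). k \<ge> \<rho>}"

definition P_minus :: "int \<Rightarrow> 'c primary set" where
  "P_minus \<rho> = {(k, c). k \<le> \<rho>}"

definition S_minus :: "('c \<Rightarrow> 'c \<Rightarrow> int) \<Rightarrow> int \<Rightarrow> 'c secondary set" where
  "S_minus \<epsilon> \<rho> = {(k, c, c'). k + \<epsilon> c c' \<le> \<rho>}"

definition O_all :: "('c \<Rightarrow> 'c \<Rightarrow> int) \<Rightarrow> 'c primary list set" where
  "O_all \<epsilon> = colored_partitions (succ_rel \<epsilon>) UNIV"

definition O_plus :: "('c \<Rightarrow> 'c \<Rightarrow> int) \<Rightarrow> int \<Rightarrow> 'c primary list set" where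
  "O_plus \<epsilon> \<rho> = colored_partitions (succ_rel \<epsilon>) (P_plus \<rho>)"

definition O_minus :: "('c \<Rightarrow> 'c \<Rightarrow> int) \<Rightarrow> int \<Rightarrow> 'c primary list set" where
  "O_minus \<epsilon> \<rho> = colored_partitions (succ_rel \<epsilon>) (P_minus \<rho>)"

definition E_all :: "('c \<Rightarrow> 'c \<Rightarrow> int) \<Rightarrow> 'c particle list set" where
  "E_all \<epsilon> = colored_partitions (gg_rel \<epsilon>) UNIV"

definition E_plus :: "('c \<Rightarrow> 'c \<Rightarrow> int) \<Rightarrow> int \<Rightarrow> 'c particle list set" where
  "E_plus \<epsilon> \<rho> = colored_partitions (gg_rel \<epsilon>) (P_plus \<rho> <+> S_plus \<rho>)"

definition E_minus :: "('c \<Rightarrow> 'c \<Rightarrow> int) \<Rightarrow> int \<Rightarrow> 'c particle list set" where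
  "E_minus \<epsilon> \<rho> = colored_partitions (gg_rel \<epsilon>) (P_minus \<rho> <+> S_minus \<epsilon> \<rho>)"

end

theory Submission
  imports Defs
begin

text \<open>
  Fix the word \<open>C\<close>. The smallest primary partition with this word and last potential 0 gives the letter
  at the head of a suffix \<open>w\<close> of \<open>C\<close> the potential \<open>ground \<epsilon> w\<close>, the sum of \<open>\<epsilon>\<close> over the adjacent letters
  of \<open>w\<close>. Subtracting these potentials turns a primary particle into an integer \<open>x\<close>, and it turns both
  halves of a secondary particle into the same integer \<open>y\<close>. In these coordinates the energy is
  \<open>\<Sum>x + 2\<Sum>y\<close> plus a constant that depends on \<open>C\<close> only.

  Read a partition in \<open>\<O>\<close> from the left and greedily combine two neighbours into a secondary particle
  whenever their potentials differ by exactly \<open>\<epsilon>\<close>. This turns \<open>\<O>\<close> into a second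
  family of partitions into primary and secondary
  particles. It has the same conditions as \<open>\<E>\<close> between two primary particles (\<open>x > x'\<close>) and
  between two secondary particles (\<open>y \<ge> y'\<close>); only the mixed conditions differ. In both families
  the mixed conditions are complementary: if the coordinates \<open>x\<close> and \<open>y\<close> are adjacent and occupy a given
  triple of letters, exactly one of the two orders is allowed. The primary
  particle comes first iff \<open>x > y\<close> in the paired family, and iff \<open>x \<ge> 2y + g\<close> in \<open>\<E>\<close>, where \<open>g\<close> is the ground
  potential of the second letter of the triple.

  The triple is known from the number of primary and secondary particles to its left, so
  merging a strictly decreasing list \<open>xs\<close> with a weakly decreasing list \<open>ys\<close> leaves no choice at any
  step. Both tests are monotone along the lists in a way that makes every partition of
  the family arise from such a merge. Hence both families are
  parametrized by the same pairs \<open>(xs, ys)\<close> with \<open>|xs| + 2|ys| = |C|\<close>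
  (\<open>interleaving.partitions_eqpoll_coordinate_pairs\<close>). The bounds on the potentials also depend
  on \<open>(xs, ys)\<close> alone, provided \<open>\<rho> \<in> {0, 1}\<close>: they say that all coordinates are at least \<open>\<rho>\<close>, or that
  all of them are at most \<open>\<rho> - ground \<epsilon> C\<close>. So one parametrization settles the unrestricted and
  the restricted cases together.
\<close>

section \<open>Ground potentials and normalized coordinates\<close>

fun ground :: "('c \<Rightarrow> 'c \<Rightarrow> int) \<Rightarrow> 'c list \<Rightarrow> int" where
  "ground \<epsilon> (c # d # w) = \<epsilon> c d + ground \<epsilon> (d # w)"
| "ground \<epsilon> _ = 0"

fun ground_energy :: "('c \<Rightarrow> 'c \<Rightarrow> int) \<Rightarrow> 'c list \<Rightarrow> int" where
  "ground_energy \<epsilon> [] = 0"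
| "ground_energy \<epsilon> (c # w) = ground \<epsilon> (c # w) + ground_energy \<epsilon> w"

lemma word_simps [simp]: "word st [] = []" "word st (p # \<pi>) = st p @ word st \<pi>"
  by (simp_all add: word_def)

lemma energy_simps [simp]: "energy pot [] = 0" "energy pot (p # \<pi>) = pot p + energy pot \<pi>"
  by (simp_all add: energy_def)

lemma minimal_energy_cases: "minimal_energy \<epsilon> \<Longrightarrow> \<epsilon> c d = 0 \<or> \<epsilon> c d = 1"
  by (simp add: minimal_energy_def)

lemma ground_tl_le: "minimal_energy \<epsilon> \<Longrightarrow> ground \<epsilon> (tl w) \<le> ground \<epsilon> w"
  by (cases w; cases "tl w") (use minimal_energy_cases[of \<epsilon> "hd w" "hd (tl w)"] in auto)

lemma ground_le_Suc_tl: "minimal_energy \<epsilon> \<Longrightarrow> ground \<epsilon> w \<le> ground \<epsilon> (tl w) + 1"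
  by (cases w; cases "tl w") (use minimal_energy_cases[of \<epsilon> "hd w" "hd (tl w)"] in auto)

lemma ground_nonneg: "minimal_energy \<epsilon> \<Longrightarrow> 0 \<le> ground \<epsilon> w"
proof (induction w)
  case (Cons c w)
  then show ?case using ground_tl_le[of \<epsilon> "c # w"] by simp
qed simp

text \<open>
  The ground potential is taken on the suffix of the word that starts at the letter carrying the
  potential. For a secondary particle \<open>(k, c, d)\<close> the potential \<open>k\<close> belongs to the lower half, hence to the
  letter \<open>d\<close>; the upper half has potential \<open>k + \<epsilon> c d\<close> at a ground potential larger by \<open>\<epsilon> c d\<close>, so it
  has the same coordinate.
\<close>

fun primary_coords :: "('c \<Rightarrow> 'c \<Rightarrow> int) \<Rightarrow> 'c particle list \<Rightarrow> int list" where
  "primary_coords \<epsilon> [] = []"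
| "primary_coords \<epsilon> (Inl (k, c) # \<nu>) = (k - ground \<epsilon> (c # word state \<nu>)) # primary_coords \<epsilon> \<nu>"
| "primary_coords \<epsilon> (Inr s # \<nu>) = primary_coords \<epsilon> \<nu>"

fun secondary_coords :: "('c \<Rightarrow> 'c \<Rightarrow> int) \<Rightarrow> 'c particle list \<Rightarrow> int list" where
  "secondary_coords \<epsilon> [] = []"
| "secondary_coords \<epsilon> (Inl p # \<nu>) = secondary_coords \<epsilon> \<nu>"
| "secondary_coords \<epsilon> (Inr (k, c, d) # \<nu>) =
     (k - ground \<epsilon> (d # word state \<nu>)) # secondary_coords \<epsilon> \<nu>"

lemma particle_list_induct [case_names Nil Primary Secondary]:
  assumes "P []"
    and "\<And>k c \<nu>. P \<nu> \<Longrightarrow> P (Inl (k, c) # \<nu>)"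
    and "\<And>k c d \<nu>. P \<nu> \<Longrightarrow> P (Inr (k, c, d) # \<nu>)"
  shows "P (\<nu> :: 'c particle list)"
proof (induction \<nu>)
  case (Cons p \<nu>)
  then show ?case using assms by (cases p) auto
qed (rule assms)

lemma particle_list_cases [case_names Nil Primary Secondary]:
  obtains "(\<nu> :: 'c particle list) = []"
    | k c \<nu>' where "\<nu> = Inl (k, c) # \<nu>'"
    | k c d \<nu>' where "\<nu> = Inr (k, c, d) # \<nu>'"
proof (cases \<nu>)
  case (Cons p \<nu>')
  then show ?thesis using that by (cases p) auto
qed (use that in auto)

lemma length_coords:
  "length (primary_coords \<epsilon> \<nu>) + 2 * length (secondary_coords \<epsilon> \<nu>) = length (word state \<nu>)"
  by (induction \<nu> rule: particle_list_induct) auto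

lemma energy_coords:
  "energy (potential \<epsilon>) \<nu> =
     sum_list (primary_coords \<epsilon> \<nu>) + 2 * sum_list (secondary_coords \<epsilon> \<nu>)
       + ground_energy \<epsilon> (word state \<nu>)"
  by (induction \<nu> rule: particle_list_induct) auto

text \<open>
  Adding the ground potentials back can only raise potentials, and by at most the
  ground potential of the whole word. So bounds on the coordinates always give bounds on the
  particles. The converse needs the interleaving conditions.
\<close>

lemma lower_bound_from_coords:
  assumes "minimal_energy \<epsilon>"
    and "\<forall>x \<in> set (primary_coords \<epsilon> \<nu>) \<union> set (secondary_coords \<epsilon> \<nu>). \<rho> \<le> x"
  shows "set \<nu> \<subseteq> P_plus \<rho> <+> S_plus \<rho>"
  using assms(2)
proof (induction \<nu> rule: particle_list_induct)
  case (Primary k c \<nu>)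
  then show ?case
    using ground_nonneg[OF assms(1), of "c # word state \<nu>"] by (auto simp: P_plus_def)
next
  case (Secondary k c d \<nu>)
  then show ?case
    using ground_nonneg[OF assms(1), of "d # word state \<nu>"] by (auto simp: S_plus_def)
qed simp

lemma upper_bound_from_coords:
  assumes "minimal_energy \<epsilon>"
    and "\<forall>x \<in> set (primary_coords \<epsilon> \<nu>) \<union> set (secondary_coords \<epsilon> \<nu>). x + g \<le> \<rho>"
    and "ground \<epsilon> (word state \<nu>) \<le> g"
  shows "set \<nu> \<subseteq> P_minus \<rho> <+> S_minus \<epsilon> \<rho>"
  using assms(2,3)
proof (induction \<nu> rule: particle_list_induct)
  case (Primary k c \<nu>)
  have "ground \<epsilon> (word state \<nu>) \<le> g"
    using Primary.prems(2) ground_tl_le[OF assms(1), of "c # word state \<nu>"] by simp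
  with Primary show ?case by (auto simp: P_minus_def)
next
  case (Secondary k c d \<nu>)
  have "ground \<epsilon> (word state \<nu>) \<le> g"
    using Secondary.prems(2) ground_tl_le[OF assms(1), of "c # d # word state \<nu>"]
      ground_tl_le[OF assms(1), of "d # word state \<nu>"] by simp
  with Secondary show ?case by (auto simp: S_minus_def)
qed simp

text \<open>
  The forced merge. The test \<open>before w x y\<close> decides whether the primary coordinate \<open>x\<close> precedes the secondary
  coordinate \<open>y\<close>. It may depend on the remaining word \<open>w\<close>, whose first three letters are those that the two
  particles occupy in either order. The last equation only catches words whose length does not fit
  the two lists.
\<close>

fun assemble ::
  "('c \<Rightarrow> 'c \<Rightarrow> int) \<Rightarrow> ('c list \<Rightarrow> int \<Rightarrow> int \<Rightarrow> bool) \<Rightarrow> 'c list \<Rightarrow> int list \<Rightarrow> int list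
     \<Rightarrow> 'c particle list" where
  "assemble \<epsilon> before (c # w) (x # xs) [] =
     Inl (x + ground \<epsilon> (c # w), c) # assemble \<epsilon> before w xs []"
| "assemble \<epsilon> before (c # d # w) [] (y # ys) =
     Inr (y + ground \<epsilon> (d # w), c, d) # assemble \<epsilon> before w [] ys"
| "assemble \<epsilon> before (c # d # w) (x # xs) (y # ys) =
     (if before (c # d # w) x y
      then Inl (x + ground \<epsilon> (c # d # w), c) # assemble \<epsilon> before (d # w) xs (y # ys)
      else Inr (y + ground \<epsilon> (d # w), c, d) # assemble \<epsilon> before w (x # xs) ys)"
| "assemble \<epsilon> before _ _ _ = []"

lemma coords_assemble:
  assumes "length w = length xs + 2 * length ys"
  shows "word state (assemble \<epsilon> before w xs ys) = w
       \<and> primary_coords \<epsilon> (assemble \<epsilon> before w xs ys) = xs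
       \<and> secondary_coords \<epsilon> (assemble \<epsilon> before w xs ys) = ys"
  using assms by (induction \<epsilon> before w xs ys rule: assemble.induct) auto

section \<open>Relations that determine the interleaving\<close>

text \<open>
  The assumptions \<open>before_PPS\<close> to \<open>before_SPS\<close> speak of three consecutive particles; the letters name
  their kinds. A tail of \<open>w\<close> is taken once for each letter that the first particle occupies.
  \<open>before_PPS\<close> and \<open>before_SSP\<close> carry the test from adjacent particles over to the first \<open>x\<close> and the first
  \<open>y\<close> of the lists, which is the pair that the merge compares. \<open>before_PSP\<close> and
  \<open>before_SPS\<close> make the coordinates of each kind decrease across a particle of the other kind.
  The last four assumptions transport bounds from one coordinate to the other.
\<close>

locale interleaving =
  fixes \<epsilon> :: "'c \<Rightarrow> 'c \<Rightarrow> int"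
    and R :: "'c particle \<Rightarrow> 'c particle \<Rightarrow> bool"
    and before :: "'c list \<Rightarrow> int \<Rightarrow> int \<Rightarrow> bool"
  assumes minimal: "minimal_energy \<epsilon>"
    and R_PP: "R (Inl (k, c)) (Inl (k', c')) \<longleftrightarrow> k - k' > \<epsilon> c c'"
    and R_SS: "R (Inr s) (Inr s') \<longleftrightarrow> succ_rel \<epsilon> (lower_half s) (upper_half \<epsilon> s')"
    and R_PS: "w = c # c' # c'' # v \<Longrightarrow>
      R (Inl (k, c)) (Inr (k', c', c'')) \<longleftrightarrow> before w (k - ground \<epsilon> w) (k' - ground \<epsilon> (c'' # v))"
    and R_SP: "w = c # c' # c'' # v \<Longrightarrow>
      R (Inr (k, c, c')) (Inl (k', c'')) \<longleftrightarrow>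
        \<not> before w (k' - ground \<epsilon> (c'' # v)) (k - ground \<epsilon> (tl w))"
    and before_PPS: "before (tl w) x' y \<Longrightarrow> x' < x \<Longrightarrow> before w x y"
    and before_SSP: "\<not> before (tl (tl w)) x y' \<Longrightarrow> y' \<le> y \<Longrightarrow> \<not> before w x y"
    and before_PSP: "before w x y \<Longrightarrow> \<not> before (tl w) x' y \<Longrightarrow> x' < x"
    and before_SPS: "\<not> before w x y \<Longrightarrow> before (tl (tl w)) x y' \<Longrightarrow> y' \<le> y"
    and before_lower: "\<rho> \<in> {0, 1} \<Longrightarrow> before w x y \<Longrightarrow> \<rho> \<le> y \<Longrightarrow> \<rho> \<le> x"
    and not_before_lower: "\<rho> \<in> {0, 1} \<Longrightarrow> \<not> before w x y \<Longrightarrow>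
      \<rho> + ground \<epsilon> (tl (tl w)) \<le> x \<Longrightarrow> \<rho> \<le> y"
    and before_upper: "\<rho> \<in> {0, 1} \<Longrightarrow> before w x y \<Longrightarrow> x + ground \<epsilon> w \<le> \<rho> \<Longrightarrow> y + ground \<epsilon> w \<le> \<rho>"
    and not_before_upper: "\<rho> \<in> {0, 1} \<Longrightarrow> \<not> before w x y \<Longrightarrow>
      y + ground \<epsilon> w \<le> \<rho> \<Longrightarrow> x + ground \<epsilon> w \<le> \<rho>"
begin

lemma successively_assemble:
  assumes "length w = length xs + 2 * length ys"
    and "sorted_wrt (>) xs" and "sorted_wrt (\<ge>) ys"
  shows "successively R (assemble \<epsilon> before w xs ys)"
  using assms
proof (induction \<epsilon>\<equiv>\<epsilon> before\<equiv>before w xs ys rule: assemble.induct)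
  case (1 c w x xs)
  then show ?case
    by (cases xs; cases w) (auto simp: R_PP)
next
  case (2 c d w y ys)
  show ?case
  proof (cases ys)
    case Nil
    then show ?thesis using 2 by simp
  next
    case (Cons y' ys')
    then obtain c' d' w' where "w = c' # d' # w'"
      using 2(2) by (cases w; cases "tl w") auto
    then show ?thesis using 2 Cons by (simp add: R_SS)
  qed
next
  case (3 c d w x xs y ys)
  show ?case
  proof (cases "before (c # d # w) x y")
    case True
    have IH: "successively R (assemble \<epsilon> before (d # w) xs (y # ys))"
      using 3 True by simp
    obtain d' w' where w: "w = d' # w'"
      using 3(3) by (cases w) auto
    show ?thesis
      using IH True 3(4)
      by (cases xs) (auto simp: w R_PP R_PS[OF refl, of _ _ _ _ _ w'])
  next
    case False
    have IH: "successively R (assemble \<epsilon> before w (x # xs) ys)"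
      using 3 False by simp
    obtain c' w' where w: "w = c' # w'"
      using 3(3) by (cases w) auto
    show ?thesis
    proof (cases ys)
      case Nil
      then show ?thesis using IH False by (simp add: w R_SP[OF refl, of _ _ _ _ _ w'])
    next
      case (Cons y' ys')
      then obtain d' w'' where w': "w' = d' # w''"
        using 3(3) w by (cases w') auto
      show ?thesis
        using IH False 3(5) by (auto simp: w w' Cons R_SS R_SP[OF refl, of _ _ _ _ _ "d' # w''"])
    qed
  qed
qed auto

text \<open>
  All three claims go through one induction from the right. The tail of the partition is
  already known to be the merge of its coordinates, so the kind of its first particle reveals
  the outcome of the test there; the conditions on three consecutive particles then
  transfer this to the test at the new particle.
\<close>

lemma coords_sorted_and_assemble:
  assumes "successively R \<nu>"
  shows "sorted_wrt (>) (primary_coords \<epsilon> \<nu>)"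
    and "sorted_wrt (\<ge>) (secondary_coords \<epsilon> \<nu>)"
    and "assemble \<epsilon> before (word state \<nu>) (primary_coords \<epsilon> \<nu>) (secondary_coords \<epsilon> \<nu>) = \<nu>"
proof -
  have "sorted_wrt (>) (primary_coords \<epsilon> \<nu>) \<and> sorted_wrt (\<ge>) (secondary_coords \<epsilon> \<nu>)
    \<and> assemble \<epsilon> before (word state \<nu>) (primary_coords \<epsilon> \<nu>) (secondary_coords \<epsilon> \<nu>) = \<nu>"
    using assms
  proof (induction \<nu> rule: particle_list_induct)
    case (Primary k c \<nu>)
    let ?w = "word state \<nu>"
    let ?x = "k - ground \<epsilon> (c # ?w)"
    from Primary have IH: "sorted_wrt (>) (primary_coords \<epsilon> \<nu>)"
      "sorted_wrt (\<ge>) (secondary_coords \<epsilon> \<nu>)"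
      "assemble \<epsilon> before ?w (primary_coords \<epsilon> \<nu>) (secondary_coords \<epsilon> \<nu>) = \<nu>"
      by (auto simp: successively_Cons)
    show ?case
    proof (cases \<nu> rule: particle_list_cases)
      case Nil
      then show ?thesis by simp
    next
      case (Primary k' c' \<nu>')
      let ?x' = "k' - ground \<epsilon> (c' # word state \<nu>')"
      have less: "?x' < ?x"
        using Primary.prems by (simp add: Primary R_PP)
      show ?thesis
      proof (cases "secondary_coords \<epsilon> \<nu>")
        case Nil
        then show ?thesis using IH less by (auto simp: Primary sorted_wrt2)
      next
        case (Cons y ys)
        obtain d' w' where w': "word state \<nu>' = d' # w'"
          using length_coords[of \<epsilon> \<nu>'] Cons by (cases "word state \<nu>'") (auto simp: Primary)
        have "before (tl (c # ?w)) ?x' y"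
          using IH(3) Cons by (auto simp: Primary w' split: if_splits)
        then have "before (c # ?w) ?x y"
          using before_PPS less by blast
        then show ?thesis using IH less Cons by (auto simp: Primary sorted_wrt2 w')
      qed
    next
      case (Secondary k' c' d' \<nu>')
      let ?y = "k' - ground \<epsilon> (d' # word state \<nu>')"
      have before: "before (c # ?w) ?x ?y"
        using Primary.prems by (simp add: Secondary R_PS[OF refl, of _ _ _ _ _ "word state \<nu>'"])
      have "x' < ?x" if "primary_coords \<epsilon> \<nu> = x' # xs" for x' xs
      proof -
        have "\<not> before (tl (c # ?w)) x' ?y"
          using IH(3) that by (auto simp: Secondary split: if_splits)
        then show ?thesis using before before_PSP by blast
      qed
      then show ?thesis
        using IH before by (cases "primary_coords \<epsilon> \<nu>") (auto simp: Secondary sorted_wrt2)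
    qed
  next
    case (Secondary k c d \<nu>)
    let ?w = "word state \<nu>"
    let ?y = "k - ground \<epsilon> (d # ?w)"
    from Secondary have IH: "sorted_wrt (>) (primary_coords \<epsilon> \<nu>)"
      "sorted_wrt (\<ge>) (secondary_coords \<epsilon> \<nu>)"
      "assemble \<epsilon> before ?w (primary_coords \<epsilon> \<nu>) (secondary_coords \<epsilon> \<nu>) = \<nu>"
      by (auto simp: successively_Cons)
    show ?case
    proof (cases \<nu> rule: particle_list_cases)
      case Nil
      then show ?thesis by simp
    next
      case (Primary k' c' \<nu>')
      let ?x = "k' - ground \<epsilon> (c' # word state \<nu>')"
      have before: "\<not> before (c # d # ?w) ?x ?y"
        using Secondary.prems by (simp add: Primary R_SP[OF refl, of _ _ _ _ _ "word state \<nu>'"])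
      have "y' \<le> ?y" if sec: "secondary_coords \<epsilon> \<nu> = y' # ys" for y' ys
      proof -
        obtain d' w' where w': "word state \<nu>' = d' # w'"
          using length_coords[of \<epsilon> \<nu>'] sec by (cases "word state \<nu>'") (auto simp: Primary)
        have "before (tl (tl (c # d # ?w))) ?x y'"
          using IH(3) sec by (auto simp: Primary w' split: if_splits)
        then show ?thesis using before before_SPS by blast
      qed
      then show ?thesis
        using IH before by (cases "secondary_coords \<epsilon> \<nu>") (auto simp: Primary sorted_wrt2)
    next
      case (Secondary k' c' d' \<nu>')
      let ?y' = "k' - ground \<epsilon> (d' # word state \<nu>')"
      have le: "?y' \<le> ?y"
        using Secondary.prems by (simp add: Secondary R_SS)
      show ?thesis
      proof (cases "primary_coords \<epsilon> \<nu>")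
        case Nil
        then show ?thesis using IH le by (auto simp: Secondary sorted_wrt2)
      next
        case (Cons x xs)
        have "\<not> before (tl (tl (c # d # ?w))) x ?y'"
          using IH(3) Cons by (auto simp: Secondary split: if_splits)
        then have "\<not> before (c # d # ?w) x ?y"
          using before_SSP le by blast
        then show ?thesis using IH le Cons by (auto simp: Secondary sorted_wrt2)
      qed
    qed
  qed simp
  then show "sorted_wrt (>) (primary_coords \<epsilon> \<nu>)"
    and "sorted_wrt (\<ge>) (secondary_coords \<epsilon> \<nu>)"
    and "assemble \<epsilon> before (word state \<nu>) (primary_coords \<epsilon> \<nu>) (secondary_coords \<epsilon> \<nu>) = \<nu>"
    by blast+
qed

text \<open>
  The test compares a leading particle with the first particle of the other kind, however far
  away that one is, since the partition is the merge of its coordinates.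
\<close>

lemma first_primary_before:
  assumes "successively R (Inl (k, c) # \<nu>)" and "secondary_coords \<epsilon> \<nu> = y # ys"
  shows "before (c # word state \<nu>) (k - ground \<epsilon> (c # word state \<nu>)) y"
proof -
  obtain d w where w: "word state \<nu> = d # w"
    using length_coords[of \<epsilon> \<nu>] assms(2) by (cases "word state \<nu>") auto
  show ?thesis
    using coords_sorted_and_assemble(3)[OF assms(1)] assms(2) by (auto simp: w split: if_splits)
qed

lemma first_secondary_not_before:
  assumes "successively R (Inr (k, c, d) # \<nu>)" and "primary_coords \<epsilon> \<nu> = x # xs"
  shows "\<not> before (c # d # word state \<nu>) x (k - ground \<epsilon> (d # word state \<nu>))"
  using coords_sorted_and_assemble(3)[OF assms(1)] assms(2) by (auto split: if_splits)

text \<open>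
  Since the coordinates decrease, the bound propagates from the last particle to the left. The delicate
  case is a secondary particle followed by primary particles only: knowing \<open>\<rho> \<le> x\<close> for the next
  primary coordinate would be too weak there. As those coordinates decrease strictly and
  ground potentials change by at most one per letter, \<open>x\<close> exceeds \<open>\<rho>\<close> by at least the
  ground potential of its letter, which is the second claim of the induction.
\<close>

lemma coords_lower_bound:
  assumes "\<rho> \<in> {0, 1}" and "successively R \<nu>" and "set \<nu> \<subseteq> P_plus \<rho> <+> S_plus \<rho>"
  shows "(\<forall>x \<in> set (primary_coords \<epsilon> \<nu>) \<union> set (secondary_coords \<epsilon> \<nu>). \<rho> \<le> x)
    \<and> (\<forall>x xs. secondary_coords \<epsilon> \<nu> = [] \<longrightarrow> primary_coords \<epsilon> \<nu> = x # xs
          \<longrightarrow> \<rho> + ground \<epsilon> (word state \<nu>) \<le> x)"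
  using assms(2,3)
proof (induction \<nu> rule: particle_list_induct)
  case (Primary k c \<nu>)
  let ?w = "word state \<nu>"
  let ?x = "k - ground \<epsilon> (c # ?w)"
  have succ: "successively R \<nu>" and sub: "set \<nu> \<subseteq> P_plus \<rho> <+> S_plus \<rho>"
    using Primary.prems by (auto simp: successively_Cons)
  note IH = Primary.IH[OF succ sub]
  show ?case
  proof (cases \<nu> rule: particle_list_cases)
    case Nil
    then show ?thesis using Primary.prems by (auto simp: P_plus_def)
  next
    case (Primary k' c' \<nu>')
    have less: "k' - ground \<epsilon> (c' # word state \<nu>') < ?x"
      using Primary.prems by (simp add: Primary R_PP)
    have "ground \<epsilon> (c # ?w) \<le> ground \<epsilon> ?w + 1"
      using ground_le_Suc_tl[OF minimal, of "c # ?w"] by simp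
    then show ?thesis using IH less by (auto simp: Primary)
  next
    case (Secondary k' c' d' \<nu>')
    have "before (c # ?w) ?x (k' - ground \<epsilon> (d' # word state \<nu>'))"
      using Primary.prems by (simp add: Secondary R_PS[OF refl, of _ _ _ _ _ "word state \<nu>'"])
    then have "\<rho> \<le> ?x"
      using before_lower[OF assms(1)] IH by (force simp: Secondary)
    then show ?thesis using IH by (auto simp: Secondary)
  qed
next
  case (Secondary k c d \<nu>)
  let ?w = "word state \<nu>"
  let ?y = "k - ground \<epsilon> (d # ?w)"
  have succ: "successively R \<nu>" and sub: "set \<nu> \<subseteq> P_plus \<rho> <+> S_plus \<rho>"
    using Secondary.prems by (auto simp: successively_Cons)
  note IH = Secondary.IH[OF succ sub]
  have "\<rho> \<le> ?y"
  proof (cases "secondary_coords \<epsilon> \<nu>")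
    case (Cons y' ys)
    then show ?thesis
      using IH coords_sorted_and_assemble(2)[OF Secondary.prems(1)] by force
  next
    case sec: Nil
    show ?thesis
    proof (cases "primary_coords \<epsilon> \<nu>")
      case Nil
      then have "?w = []" using sec length_coords[of \<epsilon> \<nu>] by simp
      then show ?thesis using Secondary.prems(2) by (auto simp: S_plus_def)
    next
      case (Cons x xs)
      then have "\<rho> + ground \<epsilon> (tl (tl (c # d # ?w))) \<le> x"
        using IH sec by simp
      then show ?thesis
        using not_before_lower[OF assms(1) first_secondary_not_before[OF Secondary.prems(1) Cons]] by simp
    qed
  qed
  then show ?case using IH by auto
qed simp

lemma lower_bound_iff:
  assumes "\<rho> \<in> {0, 1}" and "successively R \<nu>"
  shows "set \<nu> \<subseteq> P_plus \<rho> <+> S_plus \<rho> \<longleftrightarrow>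
    (\<forall>x \<in> set (primary_coords \<epsilon> \<nu>) \<union> set (secondary_coords \<epsilon> \<nu>). \<rho> \<le> x)"
  using coords_lower_bound[OF assms] lower_bound_from_coords[OF minimal] by blast

text \<open>
  The first particle decides: its potential is bounded by \<open>\<rho>\<close>, which bounds all coordinates of its
  own kind, and the test against the first particle of the other kind bounds the rest.
\<close>

lemma coords_upper_bound:
  assumes "\<rho> \<in> {0, 1}" and "successively R \<nu>" and "set \<nu> \<subseteq> P_minus \<rho> <+> S_minus \<epsilon> \<rho>"
  shows "\<forall>x \<in> set (primary_coords \<epsilon> \<nu>) \<union> set (secondary_coords \<epsilon> \<nu>).
           x + ground \<epsilon> (word state \<nu>) \<le> \<rho>"
proof (cases \<nu> rule: particle_list_cases)
  case Nil
  then show ?thesis by simp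
next
  case (Primary k c \<nu>')
  let ?g = "ground \<epsilon> (c # word state \<nu>')"
  have hd: "k - ?g + ?g \<le> \<rho>"
    using assms(3) by (auto simp: Primary P_minus_def)
  have "x + ?g \<le> \<rho>" if "x \<in> set (primary_coords \<epsilon> \<nu>)" for x
    using that hd coords_sorted_and_assemble(1)[OF assms(2)] by (auto simp: Primary)
  moreover have "x + ?g \<le> \<rho>" if x: "x \<in> set (secondary_coords \<epsilon> \<nu>)" for x
  proof -
    obtain y ys where y: "secondary_coords \<epsilon> \<nu>' = y # ys"
      using x by (cases "secondary_coords \<epsilon> \<nu>'") (auto simp: Primary)
    have "y + ?g \<le> \<rho>"
      using before_upper[OF assms(1) first_primary_before[of k c \<nu>', OF _ y] hd] assms(2)
      by (simp add: Primary)
    then show ?thesis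
      using x y coords_sorted_and_assemble(2)[OF assms(2)] by (auto simp: Primary)
  qed
  ultimately have "\<forall>x \<in> set (primary_coords \<epsilon> \<nu>) \<union> set (secondary_coords \<epsilon> \<nu>). x + ?g \<le> \<rho>"
    by blast
  then show ?thesis by (simp add: Primary)
next
  case (Secondary k c d \<nu>')
  let ?g = "ground \<epsilon> (c # d # word state \<nu>')"
  let ?y = "k - ground \<epsilon> (d # word state \<nu>')"
  have hd: "?y + ?g \<le> \<rho>"
    using assms(3) by (auto simp: Secondary S_minus_def)
  have "x + ?g \<le> \<rho>" if "x \<in> set (secondary_coords \<epsilon> \<nu>)" for x
    using that hd coords_sorted_and_assemble(2)[OF assms(2)] by (auto simp: Secondary)
  moreover have "x + ?g \<le> \<rho>" if x: "x \<in> set (primary_coords \<epsilon> \<nu>)" for x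
  proof -
    obtain x' xs where x': "primary_coords \<epsilon> \<nu>' = x' # xs"
      using x by (cases "primary_coords \<epsilon> \<nu>'") (auto simp: Secondary)
    have "x' + ?g \<le> \<rho>"
      using not_before_upper[OF assms(1) first_secondary_not_before[of k c d \<nu>', OF _ x'] hd] assms(2)
      by (simp add: Secondary)
    then show ?thesis
      using x x' coords_sorted_and_assemble(1)[OF assms(2)] by (auto simp: Secondary)
  qed
  ultimately have "\<forall>x \<in> set (primary_coords \<epsilon> \<nu>) \<union> set (secondary_coords \<epsilon> \<nu>). x + ?g \<le> \<rho>"
    by blast
  then show ?thesis by (simp add: Secondary)
qed

lemma upper_bound_iff:
  assumes "\<rho> \<in> {0, 1}" and "successively R \<nu>"
  shows "set \<nu> \<subseteq> P_minus \<rho> <+> S_minus \<epsilon> \<rho> \<longleftrightarrow>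
    (\<forall>x \<in> set (primary_coords \<epsilon> \<nu>) \<union> set (secondary_coords \<epsilon> \<nu>).
       x + ground \<epsilon> (word state \<nu>) \<le> \<rho>)"
  using coords_upper_bound[OF assms] upper_bound_from_coords[OF minimal] by blast

end

definition coordinate_pairs ::
  "('c \<Rightarrow> 'c \<Rightarrow> int) \<Rightarrow> (int \<Rightarrow> bool) \<Rightarrow> 'c list \<Rightarrow> int \<Rightarrow> (int list \<times> int list) set" where
  "coordinate_pairs \<epsilon> Q C n = {(xs, ys). length C = length xs + 2 * length ys
     \<and> sorted_wrt (>) xs \<and> sorted_wrt (\<ge>) ys
     \<and> sum_list xs + 2 * sum_list ys + ground_energy \<epsilon> C = n
     \<and> (\<forall>x \<in> set xs \<union> set ys. Q x)}"

lemma (in interleaving) partitions_eqpoll_coordinate_pairs: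
  assumes "\<And>\<nu>. successively R \<nu> \<Longrightarrow> word state \<nu> = C \<Longrightarrow>
    set \<nu> \<subseteq> A \<longleftrightarrow> (\<forall>x \<in> set (primary_coords \<epsilon> \<nu>) \<union> set (secondary_coords \<epsilon> \<nu>). Q x)"
  shows "{\<nu> \<in> colored_partitions R A. (word state \<nu>, energy (potential \<epsilon>) \<nu>) = (C, n)}
    \<approx> coordinate_pairs \<epsilon> Q C n"
proof -
  have "bij_betw (\<lambda>\<nu>. (primary_coords \<epsilon> \<nu>, secondary_coords \<epsilon> \<nu>))
      {\<nu> \<in> colored_partitions R A. (word state \<nu>, energy (potential \<epsilon>) \<nu>) = (C, n)}
      (coordinate_pairs \<epsilon> Q C n)"
  proof (rule bij_betw_byWitness[where f' = "\<lambda>(xs, ys). assemble \<epsilon> before C xs ys"])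
    show "(\<lambda>\<nu>. (primary_coords \<epsilon> \<nu>, secondary_coords \<epsilon> \<nu>)) `
        {\<nu> \<in> colored_partitions R A. (word state \<nu>, energy (potential \<epsilon>) \<nu>) = (C, n)}
        \<subseteq> coordinate_pairs \<epsilon> Q C n"
      using assms
      by (auto simp: colored_partitions_def coordinate_pairs_def length_coords energy_coords
          coords_sorted_and_assemble)
    show "(\<lambda>(xs, ys). assemble \<epsilon> before C xs ys) ` coordinate_pairs \<epsilon> Q C n
        \<subseteq> {\<nu> \<in> colored_partitions R A. (word state \<nu>, energy (potential \<epsilon>) \<nu>) = (C, n)}"
    proof clarify
      fix xs ys
      assume *: "(xs, ys) \<in> coordinate_pairs \<epsilon> Q C n"
      then have len: "length C = length xs + 2 * length ys"
        by (simp add: coordinate_pairs_def)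
      have succ: "successively R (assemble \<epsilon> before C xs ys)"
        using * by (auto simp: coordinate_pairs_def intro: successively_assemble)
      then show "assemble \<epsilon> before C xs ys \<in> colored_partitions R A
          \<and> (word state (assemble \<epsilon> before C xs ys),
             energy (potential \<epsilon>) (assemble \<epsilon> before C xs ys)) = (C, n)"
        using assms[OF succ] coords_assemble[OF len, of \<epsilon> before] *
        by (simp add: colored_partitions_def coordinate_pairs_def energy_coords)
    qed
  qed (auto simp: colored_partitions_def coords_sorted_and_assemble coordinate_pairs_def
      coords_assemble)
  then show ?thesis by (auto simp: eqpoll_def)
qed

section \<open>Pairing neighbours in primary partitions\<close>

text \<open>
  The conditions that hold after greedy pairing from the left. A primary particle that was left unpaired
  differs by more than \<open>\<epsilon>\<close> from whatever follows it; a secondary particle has had its lower half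
  taken, so this half need only satisfy the original weak inequality.
\<close>

fun paired_rel :: "('c \<Rightarrow> 'c \<Rightarrow> int) \<Rightarrow> 'c particle \<Rightarrow> 'c particle \<Rightarrow> bool" where
  "paired_rel \<epsilon> (Inl (k, c)) (Inl (k', c')) \<longleftrightarrow> k - k' > \<epsilon> c c'"
| "paired_rel \<epsilon> (Inl (k, c)) (Inr (k', c', c'')) \<longleftrightarrow> k - (k' + \<epsilon> c' c'') > \<epsilon> c c'"
| "paired_rel \<epsilon> (Inr (k, c, c')) (Inl (k', c'')) \<longleftrightarrow> k - k' \<ge> \<epsilon> c' c''"
| "paired_rel \<epsilon> (Inr s) (Inr s') \<longleftrightarrow> succ_rel \<epsilon> (lower_half s) (upper_half \<epsilon> s')"

fun halves :: "('c \<Rightarrow> 'c \<Rightarrow> int) \<Rightarrow> 'c particle list \<Rightarrow> 'c primary list" where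
  "halves \<epsilon> [] = []"
| "halves \<epsilon> (Inl p # \<nu>) = p # halves \<epsilon> \<nu>"
| "halves \<epsilon> (Inr s # \<nu>) = upper_half \<epsilon> s # lower_half s # halves \<epsilon> \<nu>"

fun pair_up :: "('c \<Rightarrow> 'c \<Rightarrow> int) \<Rightarrow> 'c primary list \<Rightarrow> 'c particle list" where
  "pair_up \<epsilon> ((k, c) # (k', c') # \<pi>) =
     (if k - k' = \<epsilon> c c' then Inr (k', c, c') # pair_up \<epsilon> \<pi>
      else Inl (k, c) # pair_up \<epsilon> ((k', c') # \<pi>))"
| "pair_up \<epsilon> [p] = [Inl p]"
| "pair_up \<epsilon> [] = []"

lemma halves_pair_up: "halves \<epsilon> (pair_up \<epsilon> \<pi>) = \<pi>"
  by (induction \<epsilon> \<pi> rule: pair_up.induct) auto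

lemma word_halves: "word primary_state (halves \<epsilon> \<nu>) = word state \<nu>"
  by (induction \<nu> rule: particle_list_induct) auto

lemma energy_halves: "energy primary_potential (halves \<epsilon> \<nu>) = energy (potential \<epsilon>) \<nu>"
  by (induction \<nu> rule: particle_list_induct) auto

lemma halves_P_plus_iff:
  assumes "minimal_energy \<epsilon>"
  shows "set (halves \<epsilon> \<nu>) \<subseteq> P_plus \<rho> \<longleftrightarrow> set \<nu> \<subseteq> P_plus \<rho> <+> S_plus \<rho>"
proof (induction \<nu> rule: particle_list_induct)
  case (Secondary k c d \<nu>)
  then show ?case using minimal_energy_cases[OF assms, of c d] by (auto simp: P_plus_def S_plus_def)
qed (auto simp: P_plus_def)

lemma halves_P_minus_iff:
  assumes "minimal_energy \<epsilon>"
  shows "set (halves \<epsilon> \<nu>) \<subseteq> P_minus \<rho> \<longleftrightarrow> set \<nu> \<subseteq> P_minus \<rho> <+> S_minus \<epsilon> \<rho>"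
proof (induction \<nu> rule: particle_list_induct)
  case (Secondary k c d \<nu>)
  then show ?case
    using minimal_energy_cases[OF assms, of c d] by (auto simp: P_minus_def S_minus_def)
qed (auto simp: P_minus_def)

lemma paired_pair_up:
  "successively (succ_rel \<epsilon>) \<pi> \<Longrightarrow> successively (paired_rel \<epsilon>) (pair_up \<epsilon> \<pi>)"
proof (induction \<epsilon> \<pi> rule: pair_up.induct)
  case (1 \<epsilon> k c k' c' \<pi>)
  show ?case
  proof (cases "k - k' = \<epsilon> c c'")
    case True
    have "successively (paired_rel \<epsilon>) (pair_up \<epsilon> \<pi>)"
      using 1 True by (auto simp: successively_Cons)
    then show ?thesis
      using 1(3) True by (cases "(\<epsilon>, \<pi>)" rule: pair_up.cases) auto
  next
    case False
    have "successively (paired_rel \<epsilon>) (pair_up \<epsilon> ((k', c') # \<pi>))"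
      using 1 False by auto
    then show ?thesis
      using 1(3) False by (cases \<pi>) (auto split: if_splits)
  qed
qed auto

lemma pair_up_halves:
  assumes "successively (paired_rel \<epsilon>) \<nu>"
  shows "pair_up \<epsilon> (halves \<epsilon> \<nu>) = \<nu> \<and> successively (succ_rel \<epsilon>) (halves \<epsilon> \<nu>)"
  using assms
proof (induction \<nu> rule: particle_list_induct)
  case (Primary k c \<nu>)
  then show ?case by (cases \<nu> rule: particle_list_cases) auto
next
  case (Secondary k c d \<nu>)
  then show ?case by (cases \<nu> rule: particle_list_cases) auto
qed simp

lemma paired_eqpoll_halves:
  assumes "\<And>\<nu>. set (halves \<epsilon> \<nu>) \<subseteq> B \<longleftrightarrow> set \<nu> \<subseteq> A"
  shows "{\<nu> \<in> colored_partitions (paired_rel \<epsilon>) A.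
            (word state \<nu>, energy (potential \<epsilon>) \<nu>) = (C, n)}
    \<approx> {\<pi> \<in> colored_partitions (succ_rel \<epsilon>) B.
            (word primary_state \<pi>, energy primary_potential \<pi>) = (C, n)}"
proof -
  have *: "word state (pair_up \<epsilon> \<pi>) = word primary_state \<pi>"
    "energy (potential \<epsilon>) (pair_up \<epsilon> \<pi>) = energy primary_potential \<pi>"
    "set (pair_up \<epsilon> \<pi>) \<subseteq> A \<longleftrightarrow> set \<pi> \<subseteq> B" for \<pi>
    using word_halves[of \<epsilon> "pair_up \<epsilon> \<pi>"] energy_halves[of \<epsilon> "pair_up \<epsilon> \<pi>"]
      assms[of "pair_up \<epsilon> \<pi>"] by (simp_all add: halves_pair_up)
  have "bij_betw (halves \<epsilon>)
      {\<nu> \<in> colored_partitions (paired_rel \<epsilon>) A.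
            (word state \<nu>, energy (potential \<epsilon>) \<nu>) = (C, n)}
      {\<pi> \<in> colored_partitions (succ_rel \<epsilon>) B.
            (word primary_state \<pi>, energy primary_potential \<pi>) = (C, n)}"
    by (rule bij_betw_byWitness[where f' = "pair_up \<epsilon>"])
      (auto simp: colored_partitions_def halves_pair_up pair_up_halves word_halves energy_halves
         * paired_pair_up, (use assms * in blast)+)
  then show ?thesis by (auto simp: eqpoll_def)
qed

section \<open>The common parametrization of both families\<close>

text \<open>
  After normalization, pairing equal neighbours in a weakly decreasing sequence is all that is left on
  this side, and the test does not depend on the word.
\<close>

lemma interleaving_paired_rel:
  fixes \<epsilon> :: "'c \<Rightarrow> 'c \<Rightarrow> int"
  assumes "minimal_energy \<epsilon>"
  shows "interleaving \<epsilon> (paired_rel \<epsilon>) (\<lambda>w x y. y < x)"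
proof unfold_locales
  fix \<rho> :: int and w :: "'c list" and x y :: int
  assume "\<not> y < x" "\<rho> + ground \<epsilon> (tl (tl w)) \<le> x"
  then show "\<rho> \<le> y"
    using ground_nonneg[OF assms, of "tl (tl w)"] by linarith
qed (use assms in auto)

text \<open>
  The doubled coordinate in the test is what makes the conditions hold although the ground potential may
  drop by two between the two tests in \<open>before_SPS\<close>: \<open>2y' < 2y + 2\<close> still yields \<open>y' \<le> y\<close>. In the same way
  \<open>2y > \<rho> - 1\<close> yields \<open>y \<ge> \<rho>\<close> because \<open>\<rho> \<le> 1\<close>, and \<open>2(y + g) \<le> \<rho> + 1\<close>, for \<open>g\<close> the ground
  potential of \<open>w\<close>, yields \<open>y + g \<le> \<rho>\<close> because \<open>\<rho> \<ge> 0\<close>.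
\<close>

lemma interleaving_gg_rel:
  fixes \<epsilon> :: "'c \<Rightarrow> 'c \<Rightarrow> int"
  assumes "minimal_energy \<epsilon>"
  shows "interleaving \<epsilon> (gg_rel \<epsilon>) (\<lambda>w x y. 2 * y + ground \<epsilon> (tl w) \<le> x)"
proof -
  have tl: "ground \<epsilon> (tl w) \<le> ground \<epsilon> w" "ground \<epsilon> w \<le> ground \<epsilon> (tl w) + 1" for w
    using ground_tl_le[OF assms] ground_le_Suc_tl[OF assms] by auto
  show ?thesis
  proof
    fix w :: "'c list" and x x' y :: int
    assume "2 * y + ground \<epsilon> (tl (tl w)) \<le> x'" "x' < x"
    then show "2 * y + ground \<epsilon> (tl w) \<le> x"
      using tl(2)[of "tl w"] by linarith
  next
    fix w :: "'c list" and x y y' :: int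
    assume "\<not> 2 * y' + ground \<epsilon> (tl (tl (tl w))) \<le> x" "y' \<le> y"
    then show "\<not> 2 * y + ground \<epsilon> (tl w) \<le> x"
      using tl(1)[of "tl w"] tl(1)[of "tl (tl w)"] by linarith
  next
    fix w :: "'c list" and x x' y :: int
    assume "2 * y + ground \<epsilon> (tl w) \<le> x" "\<not> 2 * y + ground \<epsilon> (tl (tl w)) \<le> x'"
    then show "x' < x"
      using tl(1)[of "tl w"] by linarith
  next
    fix w :: "'c list" and x y y' :: int
    assume "\<not> 2 * y + ground \<epsilon> (tl w) \<le> x" "2 * y' + ground \<epsilon> (tl (tl (tl w))) \<le> x"
    then show "y' \<le> y"
      using tl(2)[of "tl w"] tl(2)[of "tl (tl w)"] by linarith
  next
    fix \<rho> :: int and w :: "'c list" and x y :: int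
    assume "\<rho> \<in> {0, 1}" "2 * y + ground \<epsilon> (tl w) \<le> x" "\<rho> \<le> y"
    then show "\<rho> \<le> x"
      using ground_nonneg[OF assms, of "tl w"] by auto
  next
    fix \<rho> :: int and w :: "'c list" and x y :: int
    assume "\<rho> \<in> {0, 1}" "\<not> 2 * y + ground \<epsilon> (tl w) \<le> x" "\<rho> + ground \<epsilon> (tl (tl w)) \<le> x"
    then show "\<rho> \<le> y"
      using tl(2)[of "tl w"] by auto
  next
    fix \<rho> :: int and w :: "'c list" and x y :: int
    assume "\<rho> \<in> {0, 1}" "2 * y + ground \<epsilon> (tl w) \<le> x" "x + ground \<epsilon> w \<le> \<rho>"
    then show "y + ground \<epsilon> w \<le> \<rho>"
      using tl(2)[of w] by auto
  next
    fix \<rho> :: int and w :: "'c list" and x y :: int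
    assume "\<rho> \<in> {0, 1}" "\<not> 2 * y + ground \<epsilon> (tl w) \<le> x" "y + ground \<epsilon> w \<le> \<rho>"
    then show "x + ground \<epsilon> w \<le> \<rho>"
      using tl(1)[of w] by auto
  qed (use assms in auto)
qed

text \<open>
  The coordinate bound \<open>Q\<close> has to describe \<open>A\<close> for both families at once, so that the two
  parametrizations have the same pairs \<open>(xs, ys)\<close> as their range.
\<close>

lemma gg_eqpoll_primary:
  assumes "minimal_energy \<epsilon>"
    and "\<And>R before \<nu>. interleaving \<epsilon> R before \<Longrightarrow> successively R \<nu> \<Longrightarrow> word state \<nu> = C \<Longrightarrow>
      set \<nu> \<subseteq> A \<longleftrightarrow> (\<forall>x \<in> set (primary_coords \<epsilon> \<nu>) \<union> set (secondary_coords \<epsilon> \<nu>). Q x)"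
    and "\<And>\<nu>. set (halves \<epsilon> \<nu>) \<subseteq> B \<longleftrightarrow> set \<nu> \<subseteq> A"
  shows "{\<nu> \<in> colored_partitions (gg_rel \<epsilon>) A.
            (word state \<nu>, energy (potential \<epsilon>) \<nu>) = (C, n)}
    \<approx> {\<pi> \<in> colored_partitions (succ_rel \<epsilon>) B.
            (word primary_state \<pi>, energy primary_potential \<pi>) = (C, n)}"
proof -
  note gg = interleaving_gg_rel[OF assms(1)] and paired = interleaving_paired_rel[OF assms(1)]
  have 1: "{\<nu> \<in> colored_partitions (gg_rel \<epsilon>) A.
            (word state \<nu>, energy (potential \<epsilon>) \<nu>) = (C, n)} \<approx> coordinate_pairs \<epsilon> Q C n"
    by (rule interleaving.partitions_eqpoll_coordinate_pairs[OF gg assms(2)[OF gg]])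
  have 2: "{\<nu> \<in> colored_partitions (paired_rel \<epsilon>) A.
            (word state \<nu>, energy (potential \<epsilon>) \<nu>) = (C, n)} \<approx> coordinate_pairs \<epsilon> Q C n"
    by (rule interleaving.partitions_eqpoll_coordinate_pairs[OF paired assms(2)[OF paired]])
  show ?thesis
    by (rule eqpoll_trans[OF 1 eqpoll_trans[OF eqpoll_sym[OF 2] paired_eqpoll_halves[OF assms(3)]]])
qed

theorem theorem2p12:
  fixes \<epsilon> :: "'c \<Rightarrow> 'c \<Rightarrow> int" and n :: int and C :: "'c list"
  assumes "minimal_energy \<epsilon>"
  shows "(\<exists>\<Phi>. bij_betw \<Phi>
            {\<pi> \<in> O_all \<epsilon>. (word primary_state \<pi>, energy primary_potential \<pi>) = (C, n)}
            {\<nu> \<in> E_all \<epsilon>. (word state \<nu>, energy (potential \<epsilon>) \<nu>) = (C, n)})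
    \<and> (\<forall>\<rho> \<in> {0, 1}.
         {\<nu> \<in> E_plus \<epsilon> \<rho>. (word state \<nu>, energy (potential \<epsilon>) \<nu>) = (C, n)}
         \<approx> {\<pi> \<in> O_plus \<epsilon> \<rho>. (word primary_state \<pi>, energy primary_potential \<pi>) = (C, n)}
       \<and> {\<nu> \<in> E_minus \<epsilon> \<rho>. (word state \<nu>, energy (potential \<epsilon>) \<nu>) = (C, n)}
         \<approx> {\<pi> \<in> O_minus \<epsilon> \<rho>. (word primary_state \<pi>, energy primary_potential \<pi>) = (C, n)})"
proof (intro conjI ballI)
  have "{\<nu> \<in> E_all \<epsilon>. (word state \<nu>, energy (potential \<epsilon>) \<nu>) = (C, n)}
      \<approx> {\<pi> \<in> O_all \<epsilon>. (word primary_state \<pi>, energy primary_potential \<pi>) = (C, n)}"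
    unfolding E_all_def O_all_def
    by (rule gg_eqpoll_primary[OF assms, where Q = "\<lambda>_. True"]) auto
  then show "\<exists>\<Phi>. bij_betw \<Phi>
      {\<pi> \<in> O_all \<epsilon>. (word primary_state \<pi>, energy primary_potential \<pi>) = (C, n)}
      {\<nu> \<in> E_all \<epsilon>. (word state \<nu>, energy (potential \<epsilon>) \<nu>) = (C, n)}"
    using eqpoll_sym unfolding eqpoll_def by blast
next
  fix \<rho> :: int
  assume \<rho>: "\<rho> \<in> {0, 1}"
  show "{\<nu> \<in> E_plus \<epsilon> \<rho>. (word state \<nu>, energy (potential \<epsilon>) \<nu>) = (C, n)}
      \<approx> {\<pi> \<in> O_plus \<epsilon> \<rho>. (word primary_state \<pi>, energy primary_potential \<pi>) = (C, n)}"
    unfolding E_plus_def O_plus_def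
    by (rule gg_eqpoll_primary[OF assms])
      (simp_all add: interleaving.lower_bound_iff[OF _ \<rho>] halves_P_plus_iff[OF assms])
  show "{\<nu> \<in> E_minus \<epsilon> \<rho>. (word state \<nu>, energy (potential \<epsilon>) \<nu>) = (C, n)}
      \<approx> {\<pi> \<in> O_minus \<epsilon> \<rho>. (word primary_state \<pi>, energy primary_potential \<pi>) = (C, n)}"
    unfolding E_minus_def O_minus_def
    by (rule gg_eqpoll_primary[OF assms, where Q = "\<lambda>x. x + ground \<epsilon> C \<le> \<rho>"])
      (simp_all add: interleaving.upper_bound_iff[OF _ \<rho>] halves_P_minus_iff[OF assms])
qed

end
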